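(* Let $L$ be recognized by a Streett automaton with costs $\mathcal{A}$ over an alphabet $\Sigma_I\times\Sigma_O$ with $n$ states and $k$ Streett pairs, and let $f$ be the constant delay function with $f(0)=2^{n^4 2^{3k}+1}$. Then the following are equivalent: (1) Player $I$ wins $\Gamma_f(L(\mathcal{A}))$; (2) Player $I$ wins $\Gamma_{f'}(L(\mathcal{A}))$ for every delay function $f'$.
   Context: A Streett automaton with costs is a tuple $\mathcal{A}=(Q,\Sigma,q_I,\delta,(Q_j,P_j)_{j\in J},(\mathrm{Cst}_j)_{j\in J})$ with a finite set $Q$ of states, a finite alphabet $\Sigma$, an initial state $q_I$, a deterministic complete transition function $\delta\colon Q\times\Sigma\to Q$, a finite family of Streett pairs $(Q_j,P_j)$ with $Q_j,P_j\subseteq Q$ (states in $Q_j$ are requests of pair $j$, states in $P_j$ responses), and for each $j\in J$ a cost function $\mathrm{Cst}_j$ assigning to every transition $(q,a,\delta(q,a))$ either $\epsilon$ or $\mathtt{i}$. The number of Streett pairs is $|J|$. The run on $a_0a_1\cdots$ is $\rho=(q_0,a_0,q_1)(q_1,a_1,q_2)\cdots$ with $q_0=q_I$, $q_{m+1}=\delta(q_m,a_m)$. For position $n$, $\mathrm{StCor}_j(\rho,n)=0$ if $q_n\notin Q_j$, and otherwise it is the minimum, over all $n'\ge n$ with $q_{n'}\in P_j$, of the number of transitions among $(q_n,a_n,q_{n+1})\cdots(q_{n'-1},a_{n'-1},q_{n'})$ that $\mathrm{Cst}_j$ maps to $\mathtt{i}$ ($\min\emptyset=\infty$). Let $\mathrm{StCor}(\rho,n)=\max_{j\in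 J}\mathrm{StCor}_j(\rho,n)$. The run is accepting if $\limsup_{n\to\infty}\mathrm{StCor}(\rho,n)<\infty$, and $L(\mathcal{A})$ is the set of infinite words whose run is accepting. A delay function is a map $f\colon\mathbb{N}\to\mathbb{N}\setminus\{0\}$; it is constant if $f(i)=1$ for every $i>0$. For $L\subseteq(\Sigma_I\times\Sigma_O)^\omega$, the delay game $\Gamma_f(L)$ is played in rounds $i=0,1,2,\ldots$: in round $i$, Player $I$ picks $u_i\in\Sigma_I^{f(i)}$, then Player $O$ picks $v_i\in\Sigma_O$. Player $O$ wins the play if the outcome, i.e., the word over $\Sigma_I\times\Sigma_O$ pairing $u_0u_1u_2\cdots$ and $v_0v_1v_2\cdots$ letterwise, is in $L$; otherwise Player $I$ wins. A strategy for Player $I$ is a map $\tau_I\colon\Sigma_O^*\to\Sigma_I^*$ with $|\tau_I(w)|=f(|w|)$; a strategy for Player $O$ is a map $\tau_O\colon\Sigma_I^*\to\Sigma_O$. A play is consistent with $\tau_I$ if $u_i=\tau_I(v_0\cdots v_{i-1})$ for all $i$, and with $\tau_O$ if $v_i=\tau_O(u_0\cdots u_i)$ for all $i$. A strategy is winning if every consistent play is won by its owner; a player wins the game if she has a winning strategy. *)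

theory Defs
  imports Main "HOL-Library.Extended_Nat" "HOL-Library.Liminf_Limsup"
begin

datatype cost = Eps | Inc

text \<open>Streett automaton with costs over alphabet 'a, states 'q (finite type, so Q = UNIV),
  Streett pair indices J (a finite set of indices of type 'j).\<close>
record ('q, 'a, 'j) streett_cost_aut =
  init :: 'q
  delta :: "'q \<Rightarrow> 'a \<Rightarrow> 'q"
  pairs :: "'j set"
  req :: "'j \<Rightarrow> 'q set"
  resp :: "'j \<Rightarrow> 'q set"
  cst :: "'j \<Rightarrow> 'q \<Rightarrow> 'a \<Rightarrow> cost"

fun run_state :: "('q, 'a, 'j) streett_cost_aut \<Rightarrow> (nat \<Rightarrow> 'a) \<Rightarrow> nat \<Rightarrow> 'q" where
  "run_state A w 0 = init A"
| "run_state A w (Suc m) = delta A (run_state A w m) (w m)"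

definition cost_between :: "('q, 'a, 'j) streett_cost_aut \<Rightarrow> (nat \<Rightarrow> 'a) \<Rightarrow> 'j \<Rightarrow> nat \<Rightarrow> nat \<Rightarrow> nat" where
  "cost_between A w j n n' = card {m. n \<le> m \<and> m < n' \<and> cst A j (run_state A w m) (w m) = Inc}"

definition StCor_j :: "('q, 'a, 'j) streett_cost_aut \<Rightarrow> (nat \<Rightarrow> 'a) \<Rightarrow> 'j \<Rightarrow> nat \<Rightarrow> enat" where
  "StCor_j A w j n =
     (if run_state A w n \<notin> req A j then 0
      else (INF n' \<in> {n'. n \<le> n' \<and> run_state A w n' \<in> resp A j}. enat (cost_between A w j n n')))"

text \<open>Maximum over J (0 if J is empty).\<close>
definition StCor :: "('q, 'a, 'j) streett_cost_aut \<Rightarrow> (nat \<Rightarrow> 'a) \<Rightarrow> nat \<Rightarrow> enat" where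
  "StCor A w n = (SUP j \<in> pairs A. StCor_j A w j n)"

definition accepting :: "('q, 'a, 'j) streett_cost_aut \<Rightarrow> (nat \<Rightarrow> 'a) \<Rightarrow> bool" where
  "accepting A w \<longleftrightarrow> limsup (StCor A w) < \<infinity>"

definition lang :: "('q, 'a, 'j) streett_cost_aut \<Rightarrow> (nat \<Rightarrow> 'a) set" where
  "lang A = {w. accepting A w}"

definition delay_fun :: "(nat \<Rightarrow> nat) \<Rightarrow> bool" where
  "delay_fun f \<longleftrightarrow> (\<forall>i. f i > 0)"

definition constant_delay :: "(nat \<Rightarrow> nat) \<Rightarrow> bool" where
  "constant_delay f \<longleftrightarrow> delay_fun f \<and> (\<forall>i>0. f i = 1)"

definition block_start :: "(nat \<Rightarrow> nat) \<Rightarrow> nat \<Rightarrow> nat" where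
  "block_start f i = (\<Sum>j<i. f j)"

text \<open>A play is given by the input word alpha (u_0 u_1 ... concatenated, with |u_i| = f i)
  and the output word v.  u_i is the block of alpha at positions block_start f i ..< block_start f (i+1).\<close>
definition block :: "(nat \<Rightarrow> nat) \<Rightarrow> (nat \<Rightarrow> 'i) \<Rightarrow> nat \<Rightarrow> 'i list" where
  "block f alpha i = map alpha [block_start f i ..< block_start f (Suc i)]"

definition strategy_I :: "(nat \<Rightarrow> nat) \<Rightarrow> ('o list \<Rightarrow> 'i list) \<Rightarrow> bool" where
  "strategy_I f \<tau> \<longleftrightarrow> (\<forall>w. length (\<tau> w) = f (length w))"

definition consistent_I :: "(nat \<Rightarrow> nat) \<Rightarrow> ('o list \<Rightarrow> 'i list) \<Rightarrow> (nat \<Rightarrow> 'i) \<Rightarrow> (nat \<Rightarrow> 'o) \<Rightarrow> bool" where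
  "consistent_I f \<tau> alpha v \<longleftrightarrow> (\<forall>i. block f alpha i = \<tau> (map v [0..<i]))"

definition outcome :: "(nat \<Rightarrow> 'i) \<Rightarrow> (nat \<Rightarrow> 'o) \<Rightarrow> nat \<Rightarrow> 'i \<times> 'o" where
  "outcome alpha v = (\<lambda>m. (alpha m, v m))"

definition player_I_wins :: "(nat \<Rightarrow> nat) \<Rightarrow> (nat \<Rightarrow> 'i \<times> 'o) set \<Rightarrow> bool" where
  "player_I_wins f L \<longleftrightarrow>
     (\<exists>\<tau>. strategy_I f \<tau> \<and> (\<forall>alpha v. consistent_I f \<tau> alpha v \<longrightarrow> outcome alpha v \<notin> L))"

end

theory Submission
  imports Defs "HOL-Library.Sublist"
begin

text \<open>The effect of a finite word on a state is its target together with three bits per Streett pair: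
  does an increment occur, does a response occur, and is a request left open at the end? The profile
  of an input word collects all effects achievable by some output; there are at most
  \<open>N = 2 ^ (n\<^sup>2 * 2 ^ (3 * k))\<close> profiles and they form a congruence, so an input block of length
  \<open>d \<ge> N\<close> can be pumped to arbitrary length without changing its profile. Given a winning strategy
  of Player I with lookahead \<open>2 * d\<close>, she wins for any other delay function by playing pumped versions
  of its blocks of length \<open>d\<close> and replacing Player O's answers by answers with the same effect on the
  short blocks. If all costs in the long play are eventually at most \<open>b\<close>, then a request in the short
  play is answered within \<open>b + 2\<close> blocks containing increments, hence at cost at most
  \<open>(b + 2) * d\<close>: acceptance carries over from the long play to the short one.\<close>

section \<open>Block summaries\<close>

text \<open>Each letter contributes the state it is read in, not the state it leads to, so adjacent
  blocks count every position once. A response also answers a request at the same position, as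
  \<open>StCor_j\<close> allows.\<close>

fun summ :: "('q, 'a, 'j) streett_cost_aut \<Rightarrow> 'q \<Rightarrow> 'a list \<Rightarrow> 'q \<times> 'j set \<times> 'j set \<times> 'j set" where
  "summ A q [] = (q, {}, {}, {})"
| "summ A q (a # w) = (case summ A (delta A q a) w of (q', I, R, P) \<Rightarrow>
     (q', {j \<in> pairs A. cst A j q a = Inc} \<union> I, {j \<in> pairs A. q \<in> resp A j} \<union> R,
      {j \<in> pairs A. q \<in> req A j \<and> q \<notin> resp A j \<and> j \<notin> R} \<union> P))"

text \<open>The target in \<open>s\<close> is dropped: \<open>t\<close> is meant to be a summary
  started in it.\<close>

definition comb :: "'q \<times> 'j set \<times> 'j set \<times> 'j set \<Rightarrow> 'q \<times> 'j set \<times> 'j set \<times> 'j set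
    \<Rightarrow> 'q \<times> 'j set \<times> 'j set \<times> 'j set" where
  "comb s t = (case s of (q, I, R, P) \<Rightarrow> case t of (q', I', R', P') \<Rightarrow>
     (q', I \<union> I', R \<union> R', (P - R') \<union> P'))"

lemma summ_append: "summ A q (u @ v) = comb (summ A q u) (summ A (fst (summ A q u)) v)"
  by (induction u arbitrary: q) (auto simp: comb_def split: prod.splits)

lemma summ_range: "summ A q w \<in> UNIV \<times> Pow (pairs A) \<times> Pow (pairs A) \<times> Pow (pairs A)"
proof (induction w arbitrary: q)
  case (Cons a w)
  show ?case
    using Cons[of "delta A q a"] by (auto split: prod.splits)
qed simp

lemma summ_run:
  assumes "s \<le> e"
  shows "summ A (run_state A w s) (map w [s..<e]) =
    (run_state A w e,
     {j \<in> pairs A. \<exists>m. s \<le> m \<and> m < e \<and> cst A j (run_state A w m) (w m) = Inc},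
     {j \<in> pairs A. \<exists>m. s \<le> m \<and> m < e \<and> run_state A w m \<in> resp A j},
     {j \<in> pairs A. \<exists>m. s \<le> m \<and> m < e \<and> run_state A w m \<in> req A j \<and>
        (\<forall>m'. m \<le> m' \<longrightarrow> m' < e \<longrightarrow> run_state A w m' \<notin> resp A j)})"
  using assms
\<comment> \<open>The word grows on the right while \<open>summ\<close> recurses from the left;
  \<open>summ_append\<close> bridges the two.\<close>
proof (induction e rule: dec_induct)
  case base
  then show ?case by auto
next
  case (step e)
  then show ?case
    by (auto simp: summ_append comb_def less_Suc_eq) (use less_imp_le in blast)+
qed

section \<open>Profiles of input words and pumping\<close>

text \<open>All start states are recorded, since a block may be entered in any state; this makes
  profiles compositional.\<close>

definition profile :: "('q, 'i \<times> 'o, 'j) streett_cost_aut \<Rightarrow> 'i list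
    \<Rightarrow> ('q \<times> 'q \<times> 'j set \<times> 'j set \<times> 'j set) set" where
  "profile A x = {(q, summ A q (zip x z)) |q z. length z = length x}"

text \<open>An output for \<open>x @ y\<close> is an arbitrary pair of outputs for \<open>x\<close>
  and for \<open>y\<close>.\<close>

lemma profile_append:
  "profile A (x @ y) =
     {(q, comb s t) |q s t. (q, s) \<in> profile A x \<and> (fst s, t) \<in> profile A y}" (is "?L = ?R")
proof
  show "?L \<subseteq> ?R"
  proof
    fix p assume "p \<in> ?L"
    then obtain q z where p: "p = (q, summ A q (zip (x @ y) z))" and z: "length z = length (x @ y)"
      unfolding profile_def by blast
    let ?u = "take (length x) z" and ?v = "drop (length x) z"
    let ?s = "summ A q (zip x ?u)"
    have "zip (x @ y) z = zip x ?u @ zip y ?v"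
      by (simp add: zip_append1)
    then have "p = (q, comb ?s (summ A (fst ?s) (zip y ?v)))"
      by (simp add: p summ_append)
    moreover have "length ?u = length x" "length ?v = length y"
      using z by auto
    ultimately show "p \<in> ?R"
      unfolding profile_def by blast
  qed
next
  show "?R \<subseteq> ?L"
  proof
    fix p assume "p \<in> ?R"
    then obtain q u v where
      p: "p = (q, comb (summ A q (zip x u)) (summ A (fst (summ A q (zip x u))) (zip y v)))"
      and l: "length u = length x" "length v = length y"
      unfolding profile_def by blast
    have "p = (q, summ A q (zip (x @ y) (u @ v)))"
      using l by (simp add: p summ_append)
    moreover have "length (u @ v) = length (x @ y)"
      using l by simp
    ultimately show "p \<in> ?L"
      unfolding profile_def by blast
  qed
qed

lemma profile_append_cong: "profile A x = profile A x' \<Longrightarrow> profile A (x @ y) = profile A (x' @ y)"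
  by (simp add: profile_append)

text \<open>The congruence lets \<open>u\<close> absorb the copies of \<open>v\<close> one at a
  time.\<close>

lemma profile_pump:
  assumes "profile A (u @ v) = profile A u"
  shows "profile A (u @ concat (replicate m v)) = profile A u"
proof (induction m)
  case (Suc m)
  have "profile A ((u @ v) @ concat (replicate m v)) = profile A (u @ concat (replicate m v))"
    by (rule profile_append_cong[OF assms])
  then show ?case
    using Suc by simp
qed simp

text \<open>By the pigeonhole principle two prefixes of \<open>x\<close> share a profile, and the
  factor between them can be repeated.\<close>

lemma profile_long:
  fixes A :: "('q::finite, 'i \<times> 'o, 'j) streett_cost_aut"
  assumes fin: "finite (pairs A)"
    and len: "2 ^ (card (UNIV :: 'q set) ^ 2 * 2 ^ (3 * card (pairs A))) \<le> length x"
  shows "\<exists>y. L \<le> length y \<and> profile A y = profile A x"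
proof -
  define P where "P = (UNIV :: 'q set) \<times> (UNIV :: 'q set) \<times>
    Pow (pairs A) \<times> Pow (pairs A) \<times> Pow (pairs A)"
  have finP: "finite P"
    using fin by (simp add: P_def)
  have sub: "profile A y \<in> Pow P" for y
  proof -
    have "(q, summ A q w) \<in> P" for q w
      using summ_range[of A q w] by (simp add: P_def)
    then show ?thesis
      unfolding profile_def by blast
  qed
  have "card P = card (UNIV :: 'q set) ^ 2 * 2 ^ (3 * card (pairs A))"
    using fin by (simp add: P_def card_cartesian_product card_Pow power2_eq_square
        power_add mult_2 numeral_3_eq_3)
  \<comment> \<open>With the empty prefix there are \<open>length x + 1\<close> prefixes, hence more
    prefixes than profiles.\<close>
  then have card: "card (Pow P) < card {..length x}"
    using len finP by (simp add: card_Pow)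
  have "\<not> inj_on (\<lambda>i. profile A (take i x)) {..length x}"
  proof (rule pigeonhole)
    have "card ((\<lambda>i. profile A (take i x)) ` {..length x}) \<le> card (Pow P)"
      using sub finP by (intro card_mono) auto
    then show "card ((\<lambda>i. profile A (take i x)) ` {..length x}) < card {..length x}"
      using card by linarith
  qed
  then obtain i j where ij: "i < j" "j \<le> length x" "profile A (take i x) = profile A (take j x)"
    unfolding inj_on_def by (metis atMost_iff linorder_neqE_nat)
  define u v w where "u = take i x" and "v = take (j - i) (drop i x)" and "w = drop j x"
  have uv: "u @ v = take j x"
    using ij by (simp add: u_def v_def take_add[symmetric])
  have x: "x = (u @ v) @ w"
    by (simp add: uv w_def)
  have v: "length v \<ge> 1"
    using ij by (simp add: v_def)
  have "profile A (u @ v) = profile A u"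
    using ij uv by (simp add: u_def)
  then have "profile A (u @ concat (replicate L v)) = profile A (u @ v)"
    by (simp add: profile_pump)
  then have "profile A ((u @ concat (replicate L v)) @ w) = profile A x"
    unfolding x by (rule profile_append_cong)
  moreover have "L \<le> length ((u @ concat (replicate L v)) @ w)"
    using v by (simp add: length_concat sum_list_replicate trans_le_add1 trans_le_add2)
  ultimately show ?thesis by blast
qed

section \<open>Transfer of acceptance\<close>

text \<open>A minimum over responses is infinite if there are none, so a finite bound on it already
  yields a response reached at that cost.\<close>

lemma accepting_iff:
  "accepting A w \<longleftrightarrow> (\<exists>b N. \<forall>m\<ge>N. \<forall>j\<in>pairs A. run_state A w m \<in> req A j \<longrightarrow>
     (\<exists>m'\<ge>m. run_state A w m' \<in> resp A j \<and> cost_between A w j m m' \<le> b))" (is "?L \<longleftrightarrow> ?R")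
proof
  assume ?L
  then obtain b where b: "limsup (StCor A w) = enat b"
    unfolding accepting_def by (metis enat_ord_simps(4) less_infinityE)
  then have "limsup (StCor A w) < enat (Suc b)"
    by simp
  then have "\<forall>\<^sub>F m in sequentially. StCor A w m < enat (Suc b)"
    by (rule Limsup_lessD)
  then obtain N where N: "\<And>m. m \<ge> N \<Longrightarrow> StCor A w m < enat (Suc b)"
    by (auto simp: eventually_sequentially)
  show ?R
  proof (rule exI[of _ b], rule exI[of _ N], intro allI impI ballI)
    fix m j assume m: "N \<le> m" and j: "j \<in> pairs A" and r: "run_state A w m \<in> req A j"
    have "StCor_j A w j m \<le> StCor A w m"
      unfolding StCor_def using j by (rule SUP_upper)
    then have "(INF n' \<in> {n'. m \<le> n' \<and> run_state A w n' \<in> resp A j}.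
        enat (cost_between A w j m n')) < enat (Suc b)"
      using N[OF m] r by (simp add: StCor_j_def)
    then show "\<exists>m'\<ge>m. run_state A w m' \<in> resp A j \<and> cost_between A w j m m' \<le> b"
      by (auto simp: INF_less_iff)
  qed
next
  assume ?R
  then obtain b N where bN: "\<And>m j. m \<ge> N \<Longrightarrow> j \<in> pairs A \<Longrightarrow> run_state A w m \<in> req A j \<Longrightarrow>
     (\<exists>m'\<ge>m. run_state A w m' \<in> resp A j \<and> cost_between A w j m m' \<le> b)"
    by blast
  have "StCor A w m \<le> enat b" if m: "N \<le> m" for m
    unfolding StCor_def
  proof (rule SUP_least)
    fix j assume j: "j \<in> pairs A"
    show "StCor_j A w j m \<le> enat b"
    proof (cases "run_state A w m \<in> req A j")
      case True
      then obtain m' where "m' \<ge> m" "run_state A w m' \<in> resp A j" "cost_between A w j m m' \<le> b"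
        using bN[OF m j] by blast
      then show ?thesis
        using True by (auto simp: StCor_j_def intro!: INF_lower2[of m'])
    qed (simp add: StCor_j_def)
  qed
  then have "limsup (StCor A w) \<le> enat b"
    by (intro Limsup_bounded) (auto simp: eventually_sequentially)
  then show ?L
    unfolding accepting_def using order.strict_trans1 by fastforce
qed

lemma strict_mono_block:
  fixes t :: "nat \<Rightarrow> nat"
  assumes "strict_mono t" "t M \<le> p"
  obtains i where "M \<le> i" "t i \<le> p" "p < t (Suc i)"
proof -
  have "\<exists>i\<ge>M. t i \<le> p \<and> p < t (Suc i)"
    using assms(2)
  proof (induction p rule: dec_induct)
    case base
    then show ?case
      using assms(1) by (auto simp: strict_mono_Suc_iff)
  next
    case (step p)
    then obtain i where i: "i \<ge> M" "t i \<le> p" "p < t (Suc i)" by blast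
    have "t (Suc i) < t (Suc (Suc i))"
      using assms(1) by (simp add: strict_mono_Suc_iff)
    show ?case
    proof (cases "Suc p < t (Suc i)")
      case True
      then show ?thesis
        using i by (intro exI[of _ i]) simp
    next
      case False
      then show ?thesis
        using i \<open>t (Suc i) < t (Suc (Suc i))\<close> by (intro exI[of _ "Suc i"]) simp
    qed
  qed
  then show ?thesis using that by blast
qed

lemma Collect_conj_eqD: "{j \<in> S. P j} = {j \<in> S. Q j} \<Longrightarrow> j \<in> S \<Longrightarrow> P j \<longleftrightarrow> Q j"
  by blast

text \<open>A request open at the end of a block has an open counterpart in \<open>w\<close>, whose response crosses
  at most \<open>b\<close> blocks containing increments; each of these contributes at most \<open>d\<close> in \<open>w'\<close>.\<close>

lemma accepting_transfer:
  assumes s: "strict_mono s" and t: "strict_mono t"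
    and td: "\<And>i. t (Suc i) \<le> t i + d"
    and eq: "\<And>i. summ A (run_state A w (s i)) (map w [s i..<s (Suc i)]) =
                  summ A (run_state A w' (t i)) (map w' [t i..<t (Suc i)])"
    and acc: "accepting A w"
  shows "accepting A w'"
proof -
  let ?inc = "\<lambda>w j m. cst A j (run_state A w m) (w m) = Inc"
  obtain b N where bN: "\<And>m j. m \<ge> N \<Longrightarrow> j \<in> pairs A \<Longrightarrow> run_state A w m \<in> req A j \<Longrightarrow>
     (\<exists>m'\<ge>m. run_state A w m' \<in> resp A j \<and> cost_between A w j m m' \<le> b)"
    using acc unfolding accepting_iff by blast
  have sS: "s i < s (Suc i)" and tS: "t i < t (Suc i)" for i
    using s t by (auto simp: strict_mono_Suc_iff)
  \<comment> \<open>Read over run positions, equal summaries agree in three bits per block and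
    pair.\<close>
  note eq' = eq[unfolded summ_run[OF less_imp_le[OF sS]] summ_run[OF less_imp_le[OF tS]] prod.inject]
  have inc: "(\<exists>m. s i \<le> m \<and> m < s (Suc i) \<and> ?inc w j m) \<longleftrightarrow>
      (\<exists>m. t i \<le> m \<and> m < t (Suc i) \<and> ?inc w' j m)" if "j \<in> pairs A" for i j
    by (rule Collect_conj_eqD[OF eq'[THEN conjunct2, THEN conjunct1] that])
  have rsp: "(\<exists>m. s i \<le> m \<and> m < s (Suc i) \<and> run_state A w m \<in> resp A j) \<longleftrightarrow>
      (\<exists>m. t i \<le> m \<and> m < t (Suc i) \<and> run_state A w' m \<in> resp A j)" if "j \<in> pairs A" for i j
    by (rule Collect_conj_eqD[OF eq'[THEN conjunct2, THEN conjunct2, THEN conjunct1] that])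
  have opn: "(\<exists>m. s i \<le> m \<and> m < s (Suc i) \<and> run_state A w m \<in> req A j \<and>
        (\<forall>m'. m \<le> m' \<longrightarrow> m' < s (Suc i) \<longrightarrow> run_state A w m' \<notin> resp A j)) \<longleftrightarrow>
      (\<exists>m. t i \<le> m \<and> m < t (Suc i) \<and> run_state A w' m \<in> req A j \<and>
        (\<forall>m'. m \<le> m' \<longrightarrow> m' < t (Suc i) \<longrightarrow> run_state A w' m' \<notin> resp A j))" if "j \<in> pairs A" for i j
    by (rule Collect_conj_eqD[OF eq'[THEN conjunct2, THEN conjunct2, THEN conjunct2] that])
  \<comment> \<open>At most \<open>b\<close> blocks with increments lie strictly between the blocks
    of request and response; these two account for the \<open>2\<close>. Beyond \<open>t N\<close>
    only blocks \<open>i \<ge> N\<close> occur, and they start in \<open>w\<close> at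
    \<open>s i \<ge> i \<ge> N\<close>.\<close>
  have "\<exists>m'\<ge>m. run_state A w' m' \<in> resp A j \<and> cost_between A w' j m m' \<le> (b + 2) * d"
    if m: "t N \<le> m" and j: "j \<in> pairs A" and r: "run_state A w' m \<in> req A j" for m j
  proof -
    obtain i where i: "N \<le> i" "t i \<le> m" "m < t (Suc i)"
      using strict_mono_block[OF t m] .
    show ?thesis
    proof (cases "\<exists>m'\<ge>m. m' < t (Suc i) \<and> run_state A w' m' \<in> resp A j")
      case True
      then obtain m' where m': "m \<le> m'" "m' < t (Suc i)" "run_state A w' m' \<in> resp A j" by blast
      have "cost_between A w' j m m' \<le> card {m..<m'}"
        unfolding cost_between_def by (rule card_mono) auto
      also have "\<dots> \<le> d"
        using m' i td[of i] by simp
      also have "\<dots> \<le> (b + 2) * d"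
        by simp
      finally show ?thesis using m' by blast
    next
      case False
      then have "\<exists>m. t i \<le> m \<and> m < t (Suc i) \<and> run_state A w' m \<in> req A j \<and>
        (\<forall>m'. m \<le> m' \<longrightarrow> m' < t (Suc i) \<longrightarrow> run_state A w' m' \<notin> resp A j)"
        using i r by blast
      then obtain p where p: "s i \<le> p" "p < s (Suc i)" "run_state A w p \<in> req A j"
        "\<And>m'. p \<le> m' \<Longrightarrow> m' < s (Suc i) \<Longrightarrow> run_state A w m' \<notin> resp A j"
        using opn[OF j, of i] by blast
      have "N \<le> p"
        using i(1) p(1) strict_mono_imp_increasing[OF s, of i] by linarith
      then obtain p' where p': "p' \<ge> p" "run_state A w p' \<in> resp A j" "cost_between A w j p p' \<le> b"
        using bN[OF _ j p(3)] by blast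
      have "s (Suc i) \<le> p'"
        using p(4) p' not_less by blast
      then obtain i' where i': "Suc i \<le> i'" "s i' \<le> p'" "p' < s (Suc i')"
        by (rule strict_mono_block[OF s])
      then obtain q where q: "t i' \<le> q" "q < t (Suc i')" "run_state A w' q \<in> resp A j"
        using rsp[OF j, of i'] p' by blast
      have "t (Suc i) \<le> t i'"
        using i' t by (simp add: strict_mono_less_eq)
      then have mq: "m \<le> q"
        using i q by linarith
      \<comment> \<open>The blocks in \<open>K\<close> lie entirely between \<open>p\<close> and
        \<open>p'\<close>. One increment \<open>g l\<close> from each, all at distinct positions,
        bounds \<open>card K\<close> by the cost in \<open>w\<close>.\<close>
      define K where "K = {l. i < l \<and> l < i' \<and> (\<exists>m. s l \<le> m \<and> m < s (Suc l) \<and> ?inc w j m)}"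
      have finK: "finite K"
        by (rule finite_subset[of _ "{..i'}"]) (auto simp: K_def)
      have "\<forall>l\<in>K. \<exists>m. s l \<le> m \<and> m < s (Suc l) \<and> ?inc w j m"
        by (simp add: K_def)
      then have "\<exists>g. \<forall>l\<in>K. s l \<le> g l \<and> g l < s (Suc l) \<and> ?inc w j (g l)"
        by (rule bchoice)
      then obtain g where "\<forall>l\<in>K. s l \<le> g l \<and> g l < s (Suc l) \<and> ?inc w j (g l)" ..
      note g = bspec[OF this]
      have "card K \<le> cost_between A w j p p'"
        unfolding cost_between_def
      proof (rule card_inj_on_le[of g])
        show "inj_on g K"
        proof (rule linorder_inj_onI')
          fix x y assume "x \<in> K" "y \<in> K" "x < y"
          moreover have "s (Suc x) \<le> s y"
            using \<open>x < y\<close> s by (simp add: strict_mono_less_eq Suc_le_eq)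
          ultimately show "g x \<noteq> g y"
            using g[of x] g[of y] by linarith
        qed
        show "g ` K \<subseteq> {m. p \<le> m \<and> m < p' \<and> ?inc w j m}"
        proof (rule image_subsetI)
          fix l assume l: "l \<in> K"
          then have "s (Suc i) \<le> s l" "s (Suc l) \<le> s i'"
            using s by (auto simp: K_def strict_mono_less_eq Suc_le_eq)
          then show "g l \<in> {m. p \<le> m \<and> m < p' \<and> ?inc w j m}"
            using g[OF l] p(2) i'(2) by auto
        qed
      qed auto
      then have cK: "card K \<le> b"
        using p'(3) by linarith
      \<comment> \<open>By \<open>inc\<close>, an increment in \<open>w'\<close> needs one in the
        same block of \<open>w\<close>, so between the two end blocks only those in \<open>K\<close>
        matter.\<close>
      have "{x. m \<le> x \<and> x < q \<and> ?inc w' j x} \<subseteq> (\<Union>l\<in>insert i (insert i' K). {t l..<t (Suc l)})"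
      proof
        fix x assume "x \<in> {x. m \<le> x \<and> x < q \<and> ?inc w' j x}"
        then have x: "m \<le> x" "x < q" "?inc w' j x" by auto
        obtain l where l: "i \<le> l" "t l \<le> x" "x < t (Suc l)"
          by (rule strict_mono_block[OF t, of i x]) (use i x in auto)
        have "t l < t (Suc i')"
          using l x q by linarith
        then have "l \<le> i'"
          using t by (simp add: strict_mono_less)
        moreover have "\<exists>m. s l \<le> m \<and> m < s (Suc l) \<and> ?inc w j m"
          using inc[OF j, of l] l x by blast
        ultimately have "l \<in> insert i (insert i' K)"
          using l by (auto simp: K_def)
        then show "x \<in> (\<Union>l\<in>insert i (insert i' K). {t l..<t (Suc l)})"
          using l by auto
      qed
      then have "cost_between A w' j m q \<le> card (\<Union>l\<in>insert i (insert i' K). {t l..<t (Suc l)})"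
        unfolding cost_between_def using finK by (intro card_mono) auto
      also have "\<dots> \<le> (\<Sum>l\<in>insert i (insert i' K). card {t l..<t (Suc l)})"
        using finK by (intro card_UN_le) auto
      also have "\<dots> \<le> card (insert i (insert i' K)) * d"
        using sum_bounded_above[of "insert i (insert i' K)" "\<lambda>l. card {t l..<t (Suc l)}" d] td
        by (simp add: le_diff_conv add.commute)
      also have "\<dots> \<le> (b + 2) * d"
      proof (rule mult_le_mono1)
        have "card (insert i (insert i' K)) \<le> Suc (Suc (card K))"
          using finK by (simp add: card_insert_if)
        then show "card (insert i (insert i' K)) \<le> b + 2"
          using cK by linarith
      qed
      finally show ?thesis
        using mq q by blast
    qed
  qed
  then show ?thesis
    unfolding accepting_iff by blast
qed

section \<open>Limits of growing lists and strategies of Player I\<close>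

text \<open>Letter \<open>p\<close> is taken from \<open>U (Suc p)\<close>, which is long enough
  once \<open>m \<le> length (U m)\<close> holds for all \<open>m\<close>.\<close>

definition list_limit :: "(nat \<Rightarrow> 'a list) \<Rightarrow> nat \<Rightarrow> 'a" where
  "list_limit U p = U (Suc p) ! p"

lemma chain_prefix:
  assumes "\<And>m. prefix (U m) (U (Suc m))" "m \<le> m'"
  shows "prefix (U m) (U m')"
  using assms(2) by (induction rule: dec_induct) (use assms(1) prefix_order.trans in blast)+

lemma list_limit:
  assumes pre: "\<And>m. prefix (U m) (U (Suc m))" and len: "\<And>m. m \<le> length (U m)"
  shows "map (list_limit U) [0..<length (U m)] = U m"
proof (rule nth_equalityI)
  fix p assume p: "p < length (map (list_limit U) [0..<length (U m)])"
  have "prefix (U m) (U (Suc p)) \<or> prefix (U (Suc p)) (U m)"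
    using chain_prefix[of U, OF pre] by (meson linorder_le_cases)
  then have "U (Suc p) ! p = U m ! p"
    using p len[of "Suc p"] by (auto simp: prefix_def nth_append)
  then show "map (list_limit U) [0..<length (U m)] ! p = U m ! p"
    using p by (simp add: list_limit_def)
qed simp

lemma block_start_Suc: "block_start f (Suc i) = block_start f i + f i"
  by (simp add: block_start_def)

lemma block_start_mono: "i \<le> j \<Longrightarrow> block_start f i \<le> block_start f j"
  by (auto simp: block_start_def intro!: sum_mono2)

text \<open>The reply to \<open>U\<close> itself is included, hence \<open>Suc (length U)\<close>
  moves.\<close>

definition history :: "('o list \<Rightarrow> 'i list) \<Rightarrow> 'o list \<Rightarrow> 'i list" where
  "history \<tau> U = concat (map (\<lambda>l. \<tau> (take l U)) [0..<Suc (length U)])"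

lemma history_snoc: "history \<tau> (U @ [c]) = history \<tau> U @ \<tau> (U @ [c])"
  by (auto simp: history_def intro!: arg_cong[where f = concat])

lemma length_history: "strategy_I f \<tau> \<Longrightarrow> length (history \<tau> U) = block_start f (Suc (length U))"
proof (induction U rule: rev_induct)
  case Nil
  then show ?case by (simp add: history_def strategy_I_def block_start_def)
next
  case (snoc c U)
  then show ?case by (simp add: history_snoc block_start_Suc strategy_I_def)
qed

lemma history_map:
  assumes "consistent_I f \<tau> alpha v"
  shows "history \<tau> (map v [0..<i]) = map alpha [0..<block_start f (Suc i)]"
proof (induction i)
  case 0
  have "block f alpha 0 = \<tau> []"
    using assms by (simp add: consistent_I_def)
  then show ?case
    by (simp add: history_def block_def block_start_def)
next
  case (Suc i)
  have "block f alpha (Suc i) = \<tau> (map v [0..<Suc i])"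
    using assms by (auto simp: consistent_I_def)
  then have "history \<tau> (map v [0..<Suc i]) =
      map alpha [0..<block_start f (Suc i)] @ map alpha [block_start f (Suc i)..<block_start f (Suc (Suc i))]"
    using Suc history_snoc[of \<tau> "map v [0..<i]" "v i"] by (simp add: block_def)
  also have "\<dots> = map alpha [0..<block_start f (Suc (Suc i))]"
    using upt_add_eq_append[of 0 "block_start f (Suc i)" "f (Suc i)"]
    by (simp add: block_start_Suc[of f "Suc i"])
  finally show ?case .
qed

text \<open>Moves of Player I depend only on earlier outputs, and nonempty blocks make the limit
  reach every position. Used to run \<open>\<tau>\<close> against translated answers.\<close>

lemma consistent_I_exists:
  assumes st: "strategy_I f \<tau>" and df: "delay_fun f"
  shows "\<exists>alpha. consistent_I f \<tau> alpha v"
proof -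
  define U where "U = (\<lambda>i. concat (map (\<lambda>l. \<tau> (map v [0..<l])) [0..<i]))"
  have len: "length (U i) = block_start f i" for i
    using st by (induction i) (auto simp: U_def strategy_I_def block_start_def)
  have ge: "i \<le> length (U i)" for i
  proof (induction i)
    case (Suc i)
    then show ?case
      using df[unfolded delay_fun_def, THEN spec, of i] unfolding len block_start_Suc by linarith
  qed simp
  have pre: "prefix (U i) (U (Suc i))" for i
    by (simp add: U_def)
  let ?al = "list_limit U"
  have "block f ?al i = \<tau> (map v [0..<i])" for i
  proof -
    have "map ?al [0..<block_start f (Suc i)] = U i @ \<tau> (map v [0..<i])"
      using list_limit[OF pre ge, of "Suc i"] by (simp add: len) (simp add: U_def)
    moreover have "map ?al [0..<block_start f (Suc i)] = U i @ block f ?al i"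
      using list_limit[OF pre ge, of i] upt_add_eq_append[of 0 "block_start f i" "f i"]
      by (simp add: block_def block_start_Suc len)
    ultimately show ?thesis by simp
  qed
  then show ?thesis
    unfolding consistent_I_def by blast
qed

section \<open>Simulating a strategy with lookahead \<open>2 * d\<close> in an arbitrary delay game\<close>

text \<open>After \<open>m * d\<close> outputs \<open>\<tau>\<close> has fixed
  \<open>(m + 2) * d\<close> letters, so short block \<open>m + 1\<close> is known before block
  \<open>m\<close> is answered.\<close>

locale delay_simulation =
  fixes A :: "('q, 'i \<times> 'o, 'j) streett_cost_aut"
    and \<tau> :: "'o list \<Rightarrow> 'i list" and f f' :: "nat \<Rightarrow> nat" and d :: nat
  assumes strategy: "strategy_I f \<tau>"
    and f_0: "f 0 = 2 * d" and f_Suc: "f (Suc i) = 1" and d_pos: "0 < d"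
    and pump: "length x = d \<Longrightarrow> \<exists>y. L \<le> length y \<and> profile A y = profile A x"
    and delay: "delay_fun f'"
begin

definition pumped :: "nat \<Rightarrow> 'i list \<Rightarrow> 'i list" where
  "pumped L x = (SOME y. L \<le> length y \<and> profile A y = profile A x)"

text \<open>Translates an answer \<open>z\<close> to the long block \<open>y\<close> into one for
  the short block \<open>x\<close>; equal profiles make the choice succeed.\<close>

definition answer :: "'q \<Rightarrow> 'i list \<Rightarrow> 'i list \<Rightarrow> 'o list \<Rightarrow> 'o list" where
  "answer q x y z = (SOME z'. length z' = length x \<and> summ A q (zip x z') = summ A q (zip y z))"

text \<open>The components of the state are the input of the long play before block \<open>m\<close>,
  block \<open>m\<close> of the long play, block \<open>m\<close> of the short play, and the output of the short play before
  block \<open>m\<close>. A new long block is made long enough to supply Player I with letters until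
  the current one has been answered completely.\<close>

primrec sim :: "(nat \<Rightarrow> 'o) \<Rightarrow> nat \<Rightarrow> 'i list \<times> 'i list \<times> 'i list \<times> 'o list" where
  "sim v 0 = (let x = take d (history \<tau> []) in ([], pumped 1 x, x, []))"
| "sim v (Suc m) = (case sim v m of (a, y, x, U) \<Rightarrow>
     let q = fst (summ A (init A) (zip a (map v [0..<length a])));
         x' = take d (drop (length U + d) (history \<tau> U))
     in (a @ y, pumped (Suc (block_start f' (length (a @ y)))) x', x',
         U @ answer q x y (map v [length a..<length (a @ y)])))"

definition "long v m = fst (sim v m)"
definition "long_block v m = fst (snd (sim v m))"
definition "short_block v m = fst (snd (snd (sim v m)))"
definition "short_out v m = snd (snd (snd (sim v m)))"

lemmas sim_defs = long_def long_block_def short_block_def short_out_def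

lemma sim_0:
  "long v 0 = []" "long_block v 0 = pumped 1 (short_block v 0)"
  "short_block v 0 = take d (history \<tau> [])" "short_out v 0 = []"
  by (simp_all add: sim_defs Let_def)

lemma sim_Suc:
  "long v (Suc m) = long v m @ long_block v m"
  "long_block v (Suc m) = pumped (Suc (block_start f' (length (long v (Suc m))))) (short_block v (Suc m))"
  "short_block v (Suc m) = take d (drop (length (short_out v m) + d) (history \<tau> (short_out v m)))"
  "short_out v (Suc m) = short_out v m @
     answer (fst (summ A (init A) (zip (long v m) (map v [0..<length (long v m)]))))
       (short_block v m) (long_block v m) (map v [length (long v m)..<length (long v (Suc m))])"
  by (simp_all add: sim_defs Let_def split: prod.splits)

lemma pumped:
  assumes "length x = d"
  shows "L \<le> length (pumped L x)" "profile A (pumped L x) = profile A x"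
  using someI_ex[OF pump[OF assms, of L]] by (simp_all add: pumped_def)

lemma answer:
  assumes "length z = length y" "profile A y = profile A x"
  shows "length (answer q x y z) = length x"
    and "summ A q (zip x (answer q x y z)) = summ A q (zip y z)"
proof -
  have "(q, summ A q (zip y z)) \<in> profile A x"
    using assms unfolding profile_def by blast
  then have "\<exists>z'. length z' = length x \<and> summ A q (zip x z') = summ A q (zip y z)"
    unfolding profile_def by force
  from someI_ex[OF this]
  show "length (answer q x y z) = length x"
    and "summ A q (zip x (answer q x y z)) = summ A q (zip y z)"
    by (simp_all add: answer_def)
qed

lemma block_start_f: "block_start f (Suc i) = 2 * d + i"
  by (induction i) (simp_all add: block_start_Suc f_Suc, simp add: block_start_def f_0)

lemma sim_invariant:
  "length (short_block v m) = d \<and> length (short_out v m) = m * d \<and>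
   profile A (long_block v m) = profile A (short_block v m) \<and> 0 < length (long_block v m)"
proof (induction m)
  case 0
  have "length (short_block v 0) = d"
    using length_history[OF strategy, of "[]"] by (simp add: sim_0 block_start_f)
  then show ?case
    using pumped[of "short_block v 0" 1] by (auto simp: sim_0(2,4))
next
  case (Suc m)
  have x: "length (short_block v (Suc m)) = d"
    using length_history[OF strategy, of "short_out v m"] by (simp add: sim_Suc block_start_f)
  have "length (short_out v (Suc m)) = Suc m * d"
    using Suc answer(1)[of "map v [length (long v m)..<length (long v (Suc m))]" "long_block v m"]
    by (simp add: sim_Suc(1,4))
  then show ?case
    using x pumped[OF x, of "Suc (block_start f' (length (long v (Suc m))))"]
    by (auto simp: sim_Suc(2))
qed

section \<open>Causality of the simulation and the resulting strategy\<close>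

lemma sim_causal:
  assumes "\<And>i. i < length (long v m) \<Longrightarrow> v i = v' i"
  shows "sim v m = sim v' m"
  using assms
proof (induction m)
  case (Suc m)
  then have eq: "sim v m = sim v' m"
    by (simp add: sim_Suc(1))
  obtain a y x U where s: "sim v m = (a, y, x, U)"
    by (metis prod_cases4)
  then have "length (long v (Suc m)) = length (a @ y)"
    by (simp add: sim_defs Let_def)
  then have "map v [0..<length a] = map v' [0..<length a]"
    "map v [length a..<length (a @ y)] = map v' [length a..<length (a @ y)]"
    using Suc.prems by auto
  then show ?case
    by (simp only: sim.simps eq[symmetric] s prod.case)
qed simp

text \<open>The answer to block \<open>m\<close> enters \<open>sim v (Suc m)\<close> only through
  the short output, so block \<open>m + 1\<close> of the long play is fixed before block
  \<open>m\<close> is answered.\<close>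

lemma long_causal:
  assumes "\<And>i. i < length (long v m) \<Longrightarrow> v i = v' i"
  shows "long v' (Suc (Suc m)) = long v (Suc (Suc m))"
  using sim_causal[OF assms] by (simp add: sim_defs Let_def split: prod.splits)

text \<open>The length requested from \<open>pumped\<close> pays off here: block
  \<open>m + 1\<close> suffices for all rounds until block \<open>m\<close> is answered.\<close>

lemma long_length: "block_start f' (length (long v (Suc m))) \<le> length (long v (Suc (Suc m)))"
  using pumped(1)[of "short_block v (Suc m)" "Suc (block_start f' (length (long v (Suc m))))"]
    sim_invariant[of v "Suc m"]
  by (simp add: sim_Suc(1)[of v "Suc m"] sim_Suc(2))

lemma strict_mono_long: "strict_mono (\<lambda>m. length (long v m))"
  using sim_invariant[of v] by (simp add: strict_mono_Suc_iff sim_Suc(1))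

lemma map_list_limit_long: "map (list_limit (long v)) [0..<length (long v m)] = long v m"
  by (rule list_limit)
    (simp add: sim_Suc(1), rule strict_mono_imp_increasing[OF strict_mono_long])

text \<open>Unseen outputs are filled with \<open>undefined\<close>; by
  \<open>list_limit_long_causal\<close> the letters played do not depend on them.\<close>

definition strat :: "'o list \<Rightarrow> 'i list" where
  "strat w = map (list_limit (long (\<lambda>i. if i < length w then w ! i else undefined)))
     [block_start f' (length w)..<block_start f' (Suc (length w))]"

lemma strategy_I_strat: "strategy_I f' strat"
  by (simp add: strategy_I_def strat_def block_start_Suc)

text \<open>Round \<open>i\<close> falls into some long block \<open>m\<close>. The outputs before
  it fix the long input through block \<open>m + 1\<close>, which covers all letters due by round
  \<open>i\<close>.\<close>

lemma list_limit_long_causal: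
  assumes "\<And>l. l < i \<Longrightarrow> v l = v' l" and p: "p < block_start f' (Suc i)"
  shows "list_limit (long v) p = list_limit (long v') p"
proof -
  obtain m where m: "length (long v m) \<le> i" "i < length (long v (Suc m))"
    using strict_mono_block[OF strict_mono_long[of v], of 0 i] by (auto simp: sim_0)
  have eq: "long v' (Suc (Suc m)) = long v (Suc (Suc m))"
    using assms(1) m(1) by (intro long_causal) auto
  have "p < length (long v (Suc (Suc m)))"
    using p block_start_mono[of "Suc i" "length (long v (Suc m))" f'] m(2) long_length[of v m]
    by linarith
  then show ?thesis
    using map_list_limit_long[of v "Suc (Suc m)"] map_list_limit_long[of v' "Suc (Suc m)"] eq
    by (metis add_0 diff_zero length_upt nth_map nth_upt)
qed

lemma strict_mono_block_start: "strict_mono (block_start f')"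
  using delay by (simp add: strict_mono_Suc_iff block_start_Suc delay_fun_def)

lemma consistent_strat:
  assumes "consistent_I f' strat alpha v"
  shows "alpha = list_limit (long v)"
proof
  fix p
  have "block_start f' 0 \<le> p"
    by (simp add: block_start_def)
  then obtain i where i: "block_start f' i \<le> p" "p < block_start f' (Suc i)"
    using strict_mono_block[OF strict_mono_block_start] by blast
  let ?v = "\<lambda>l. if l < length (map v [0..<i]) then map v [0..<i] ! l else undefined"
  have "map alpha [block_start f' i..<block_start f' (Suc i)] =
      map (list_limit (long ?v)) [block_start f' i..<block_start f' (Suc i)]"
    using assms by (simp add: consistent_I_def block_def strat_def)
  then have "alpha p = list_limit (long ?v) p"
    using i by (simp only: map_eq_conv set_upt atLeastLessThan_iff)
  also have "\<dots> = list_limit (long v) p"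
    by (rule list_limit_long_causal[OF _ i(2)]) simp
  finally show "alpha p = list_limit (long v) p" .
qed

lemma winning_strat:
  assumes win: "\<And>alpha v. consistent_I f \<tau> alpha v \<Longrightarrow> outcome alpha v \<notin> lang A"
    and cons: "consistent_I f' strat alpha v"
  shows "outcome alpha v \<notin> lang A"
proof
  assume "outcome alpha v \<in> lang A"
  \<comment> \<open>The translated answers form the output of the short play, in which
    \<open>\<tau>\<close> supplies the input \<open>alpha0\<close>.\<close>
  define v0 where "v0 = list_limit (short_out v)"
  have "delay_fun f"
    unfolding delay_fun_def
  proof
    show "f i > 0" for i
      using f_0 f_Suc d_pos by (cases i) auto
  qed
  then obtain alpha0 where alpha0: "consistent_I f \<tau> alpha0 v0"
    using consistent_I_exists[OF strategy] by blast
  define w w0 where "w = outcome alpha v" and "w0 = outcome alpha0 v0"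
  let ?s = "\<lambda>m. length (long v m)" and ?t = "\<lambda>m. m * d"
  have alpha: "map alpha [0..<?s m] = long v m" for m
    using consistent_strat[OF cons] map_list_limit_long by simp
  have out: "map v0 [0..<?t m] = short_out v m" for m
  proof -
    have "map v0 [0..<length (short_out v m)] = short_out v m"
      unfolding v0_def using sim_invariant[of v] d_pos
      by (intro list_limit) (simp_all add: sim_Suc(4))
    then show ?thesis
      using sim_invariant[of v m] by simp
  qed
  have sS: "?s m \<le> ?s (Suc m)" for m
    by (simp add: sim_Suc(1))
  have split: "map g [0..<j] = map g [0..<i] @ map g [i..<j]" if "i \<le> j" for g :: "nat \<Rightarrow> 'x" and i j
    using upt_add_eq_append[of 0 i "j - i"] that by (simp flip: map_append)
  have long_block: "long_block v m = map alpha [?s m..<?s (Suc m)]" for m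
    using alpha[of "Suc m"] alpha[of m] split[OF sS, of alpha m] by (simp add: sim_Suc(1))
  \<comment> \<open>Block \<open>0\<close> lies in the opening move; block \<open>l + 1\<close> is
    the end of the history after \<open>l * d\<close> outputs.\<close>
  have short_block: "short_block v m = map alpha0 [?t m..<?t (Suc m)]" for m
  proof (cases m)
    case 0
    then show ?thesis
      using history_map[OF alpha0, of 0] by (simp add: sim_0 block_start_f take_map)
  next
    case (Suc l)
    have "history \<tau> (short_out v l) = map alpha0 [0..<d + (d + l * d)]"
      using history_map[OF alpha0, of "l * d"] by (simp add: out block_start_f mult_2 add.assoc)
    then show ?thesis
      using Suc sim_invariant[of v l]
      by (simp add: sim_Suc(3) take_map drop_map add.commute)
  qed
  have state: "fst (summ A (init A) (zip (long v m) (map v [0..<?s m]))) = run_state A w (?s m)" for m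
  proof -
    have "zip (long v m) (map v [0..<?s m]) = map w [0..<?s m]"
      by (subst alpha[symmetric]) (simp add: zip_map_map zip_same_conv_map w_def outcome_def)
    then show ?thesis
      using summ_run[of 0 "?s m" A w] by simp
  qed
  \<comment> \<open>Both summaries start in the state of the long run; \<open>run_eq\<close> then
    shows inductively that the short run is in it too.\<close>
  have answer': "summ A (run_state A w (?s m)) (map w [?s m..<?s (Suc m)]) =
      summ A (run_state A w (?s m)) (map w0 [?t m..<?t (Suc m)])" for m
  proof -
    let ?z = "map v [?s m..<?s (Suc m)]"
    have "short_out v (Suc m) = short_out v m @
        answer (run_state A w (?s m)) (short_block v m) (long_block v m) ?z"
      by (simp only: sim_Suc(4) state)
    then have "answer (run_state A w (?s m)) (short_block v m) (long_block v m) ?z =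
        map v0 [?t m..<?t (Suc m)]"
      using split[of "?t m" "?t (Suc m)" v0] out[of m] out[of "Suc m"] by simp
    moreover have "length ?z = length (long_block v m)"
      by (simp add: sim_Suc(1))
    moreover have "zip (long_block v m) ?z = map w [?s m..<?s (Suc m)]"
      unfolding long_block by (simp add: zip_map_map zip_same_conv_map w_def outcome_def)
    moreover have "zip (short_block v m) (map v0 [?t m..<?t (Suc m)]) = map w0 [?t m..<?t (Suc m)]"
      unfolding short_block by (simp add: zip_map_map zip_same_conv_map w0_def outcome_def)
    ultimately show ?thesis
      using answer(2)[of ?z "long_block v m" "short_block v m"] sim_invariant[of v m] by metis
  qed
  have run_eq: "run_state A w (?s m) = run_state A w0 (?t m)" for m
  proof (induction m)
    case 0
    then show ?case by (simp add: sim_0)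
  next
    case (Suc m)
    have "?t m \<le> ?t (Suc m)" by simp
    then show ?case
      using arg_cong[OF answer'[of m], of fst] summ_run[OF sS, of A w m]
        summ_run[of "?t m" "?t (Suc m)" A w0] by (simp only: Suc fst_conv)
  qed
  have "accepting A w0"
  proof (rule accepting_transfer[OF strict_mono_long[of v], of ?t d A w w0])
    show "strict_mono ?t"
      using d_pos by (simp add: strict_mono_Suc_iff)
    show "summ A (run_state A w (?s m)) (map w [?s m..<?s (Suc m)]) =
      summ A (run_state A w0 (?t m)) (map w0 [?t m..<?t (Suc m)])" for m
      using answer'[of m] by (simp only: run_eq)
    show "accepting A w"
      using \<open>outcome alpha v \<in> lang A\<close> by (simp add: w_def lang_def)
  qed simp
  then show False
    using win[OF alpha0] by (simp add: w0_def lang_def)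
qed

end

theorem theorem3:
  fixes A :: "('q::finite, 'i::finite \<times> 'o::finite, 'j) streett_cost_aut"
    and f :: "nat \<Rightarrow> nat" and n k :: nat
  assumes "finite (pairs A)"
    and "n = card (UNIV :: 'q set)"
    and "k = card (pairs A)"
    and "constant_delay f"
    and "f 0 = 2 ^ (n ^ 4 * 2 ^ (3 * k) + 1)"
  shows "player_I_wins f (lang A) \<longleftrightarrow> (\<forall>f'. delay_fun f' \<longrightarrow> player_I_wins f' (lang A))"
proof
  assume "player_I_wins f (lang A)"
  then obtain \<tau> where \<tau>: "strategy_I f \<tau>"
    "\<And>alpha v. consistent_I f \<tau> alpha v \<Longrightarrow> outcome alpha v \<notin> lang A"
    unfolding player_I_wins_def by blast
  \<comment> \<open>The \<open>+ 1\<close> in the exponent of \<open>f 0\<close> is the factor in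
    \<open>f 0 = 2 * d\<close>.\<close>
  define d :: nat where "d = 2 ^ (n ^ 4 * 2 ^ (3 * k))"
  show "\<forall>f'. delay_fun f' \<longrightarrow> player_I_wins f' (lang A)"
  proof (intro allI impI)
    fix f' assume f': "delay_fun f'"
    interpret delay_simulation A \<tau> f f' d
    proof
      \<comment> \<open>Types are inhabited, so \<open>n ^ 4\<close> dominates the
        \<open>n ^ 2\<close> in the length required by \<open>profile_long\<close>.\<close>
      have "n > 0"
        using assms(2) by (simp add: card_gt_0_iff)
      then have "n ^ 2 \<le> n ^ 4"
        by (intro power_increasing) auto
      then have "n ^ 2 * 2 ^ (3 * k) \<le> n ^ 4 * 2 ^ (3 * k)"
        by (rule mult_le_mono1)
      then have "(2::nat) ^ (n ^ 2 * 2 ^ (3 * k)) \<le> d"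
        unfolding d_def by (rule power_increasing) simp
      then show "\<exists>y. L \<le> length y \<and> profile A y = profile A x" if "length x = d" for L x
        using profile_long[of A x L] assms(1-3) that by simp
    qed (use assms(4,5) \<tau>(1) f' in \<open>simp_all add: d_def constant_delay_def\<close>)
    show "player_I_wins f' (lang A)"
      unfolding player_I_wins_def using strategy_I_strat winning_strat[OF \<tau>(2)] by blast
  qed
next
  assume "\<forall>f'. delay_fun f' \<longrightarrow> player_I_wins f' (lang A)"
  then show "player_I_wins f (lang A)"
    using assms(4) by (simp add: constant_delay_def)
qed

end
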